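(* Let $n\ge 3$ and let $\mathcal{P}$ be an integral point set in the plane $\mathbb{E}^2$ consisting of $n$ points, $n-1$ of which lie on a common line. Then for every integer $m\ge 2$, $d(m,n-2+m)\le \operatorname{diam}(\mathcal{P})$.
   Context: An integral point set in the $m$-dimensional Euclidean space $\mathbb{E}^m$ is a set of $n$ points in $\mathbb{E}^m$ whose pairwise Euclidean distances are all integers and which are not all contained in a common affine hyperplane of $\mathbb{E}^m$ (for $m=2$: not all on one line). Its diameter $\operatorname{diam}(\mathcal{P})$ is the largest distance between two of its points. For integers $n\ge m+1$, $d(m,n)$ denotes the minimum possible diameter of an integral point set in $\mathbb{E}^m$ consisting of $n$ points. *)

theory Defs
  imports "HOL-Analysis.Analysis"
begin

definition integral_point_set :: "'a::euclidean_space set \<Rightarrow> bool" where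
  "integral_point_set S \<longleftrightarrow>
     finite S \<and>
     (\<forall>x\<in>S. \<forall>y\<in>S. dist x y \<in> \<int>) \<and>
     \<not> (\<exists>a b. a \<noteq> 0 \<and> S \<subseteq> {x. a \<bullet> x = b})"

text \<open>
  \<open>min_diam TYPE(real ^ 'm) n\<close> is \<open>d(m, n)\<close> with \<open>m = CARD('m)\<close>. The value is unspecified
  if there is no integral point set of \<open>n\<close> points; otherwise the minimum is attained, see
  \<open>min_diam_attained\<close>.
\<close>

definition min_diam :: "'a::euclidean_space itself \<Rightarrow> nat \<Rightarrow> real" where
  "min_diam TYPE('a) n =
     (LEAST r. \<exists>S :: 'a set. integral_point_set S \<and> card S = n \<and> diameter S = r)"

lemma diameter_integral_point_set_Nats:
  assumes "integral_point_set S"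
  shows "diameter S \<in> \<nat>"
proof (cases "S = {}")
  case False
  let ?D = "(\<lambda>(x, y). dist x y) ` (S \<times> S)"
  have fin: "finite ?D" and ne: "?D \<noteq> {}"
    using assms False by (auto simp: integral_point_set_def)
  have "diameter S = Max ?D"
    using False cSup_eq_Max[OF fin ne] by (simp add: diameter_def)
  also have "\<dots> \<in> ?D" using fin ne by (rule Max_in)
  finally show ?thesis
    using assms by (auto simp: integral_point_set_def Nats_altdef2)
qed (simp add: diameter_def)

lemma min_diam_attained:
  fixes S :: "'a::euclidean_space set"
  assumes "integral_point_set S" "card S = n"
  shows "\<exists>T :: 'a set. integral_point_set T \<and> card T = n \<and> diameter T = min_diam TYPE('a) n"
    and "min_diam TYPE('a) n \<le> diameter S"
proof -
  let ?P = "\<lambda>r. \<exists>T :: 'a set. integral_point_set T \<and> card T = n \<and> diameter T = r"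
  define k where "k = (LEAST k. ?P (real k))"
  have nat: "\<exists>j. r = real j" if "?P r" for r
    using that diameter_integral_point_set_Nats by (metis Nats_cases)
  then have ex: "\<exists>j. ?P (real j)" using assms by metis
  have Pk: "?P (real k)" unfolding k_def using ex by (rule LeastI_ex)
  have le: "real k \<le> r" if r: "?P r" for r
  proof -
    obtain j where "r = real j" using nat r by blast
    then show ?thesis using r unfolding k_def by (auto intro!: Least_le)
  qed
  have eq: "min_diam TYPE('a) n = real k"
    unfolding min_diam_def by (rule Least_equality) (use Pk le in blast)+
  show "\<exists>T :: 'a set. integral_point_set T \<and> card T = n \<and> diameter T = min_diam TYPE('a) n"
    using Pk eq by simp
  show "min_diam TYPE('a) n \<le> diameter S"
    unfolding eq using assms le by blast
qed

end

theory Submission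
  imports Defs
begin

text \<open>
  Keep the \<open>n - 1\<close> collinear points on a coordinate axis of \<open>\<real>\<^sup>m\<close> and replace the remaining point, at
  distance \<open>h\<close> from the line, by \<open>m - 1\<close> points with the same foot on the axis and the same distance
  \<open>h\<close> from it, forming a regular simplex of side length 1. Such a simplex has circumradius below
  \<open>1 / \<surd>2\<close>, so it can be placed off the origin of the orthogonal complement whenever \<open>h\<^sup>2 > 1/2\<close>.
  By Heron's formula, a nondegenerate integral triangle has all its heights at least \<open>\<surd>3 / 2\<close>.
\<close>

text \<open>The sides are \<open>a\<close>, \<open>b\<close>, \<open>c\<close>, and
  \<open>foot\<close> is the law of cosines: \<open>x\<close> locates the foot of the altitude on
  \<open>c\<close>, measured from the vertex shared with \<open>a\<close>, so
  \<open>a^2 - x^2\<close> is the squared height. Integrality makes both strict triangle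
  inequalities hold with a margin of 1, which bounds each of Heron's two factors from below.\<close>

lemma integral_triangle_height_ge:
  fixes a b c x :: real
  assumes ints: "a \<in> \<int>" "b \<in> \<int>" "c \<in> \<int>"
    and c: "c > 0" and a: "a \<ge> 0" and b: "b \<ge> 0"
    and tri: "a \<le> b + c" "b \<le> a + c"
    and foot: "2 * x * c = a\<^sup>2 + c\<^sup>2 - b\<^sup>2"
    and pos: "a\<^sup>2 - x\<^sup>2 > 0"
  shows "a\<^sup>2 - x\<^sup>2 \<ge> 3/4"
proof -
  obtain i j k :: int where ijk: "a = of_int i" "b = of_int j" "c = of_int k"
    using ints by (metis Ints_cases)
  define X Y where "X = (a + b)\<^sup>2 - c\<^sup>2" and "Y = c\<^sup>2 - (a - b)\<^sup>2"
  have "4 * (a\<^sup>2 - x\<^sup>2) * c\<^sup>2 = 4 * a\<^sup>2 * c\<^sup>2 - (2 * x * c)\<^sup>2"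
    by (simp add: power2_eq_square algebra_simps)
  also have "\<dots> = X * Y"
    unfolding foot X_def Y_def by algebra
  finally have heron: "4 * (a\<^sup>2 - x\<^sup>2) * c\<^sup>2 = X * Y" .
  \<comment> \<open>Positivity of \<open>X * Y\<close> alone would allow two negative factors; the
    triangle inequality excludes this.\<close>
  have "(a - b)\<^sup>2 \<le> c\<^sup>2"
    using tri c by (intro abs_le_square_iff[THEN iffD1]) auto
  then have "Y \<ge> 0" by (simp add: Y_def)
  moreover have "X * Y > 0"
    using pos c heron by (metis mult_pos_pos zero_less_numeral zero_less_power)
  ultimately have "X > 0" "Y > 0"
    by (auto simp: zero_less_mult_iff)
  then have "c < a + b" "\<bar>a - b\<bar> < c"
    using a b c power2_less_imp_less[of c "a + b"] power2_less_imp_less[of "\<bar>a - b\<bar>" c]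
    by (auto simp: X_def Y_def)
  then have "k + 1 \<le> i + j" "\<bar>i - j\<bar> \<le> k - 1"
    unfolding ijk by linarith+
  then have ab: "c + 1 \<le> a + b" "\<bar>a - b\<bar> \<le> c - 1" and c1: "c \<ge> 1"
    unfolding ijk by linarith+
  have "(c + 1)\<^sup>2 \<le> (a + b)\<^sup>2"
    using ab c by (intro power_mono) auto
  then have X: "X \<ge> 2 * c + 1"
    by (simp add: X_def power2_eq_square algebra_simps)
  have "(a - b)\<^sup>2 \<le> (c - 1)\<^sup>2"
    using ab by (intro abs_le_square_iff[THEN iffD1]) auto
  then have Y: "Y \<ge> 2 * c - 1"
    by (simp add: Y_def power2_eq_square algebra_simps)
  \<comment> \<open>The left side is \<open>4 * c^2 - 1\<close>, which is at least
    \<open>3 * c^2\<close> because \<open>c >= 1\<close>; dividing by \<open>4 * c^2\<close> yields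
    3/4.\<close>
  have "(2 * c + 1) * (2 * c - 1) \<le> X * Y"
    using X Y c1 by (intro mult_mono) auto
  then have "4 * c\<^sup>2 - 1 \<le> 4 * (a\<^sup>2 - x\<^sup>2) * c\<^sup>2"
    unfolding heron by (simp add: power2_eq_square algebra_simps)
  moreover have "c\<^sup>2 \<ge> 1" using c1 by simp
  ultimately have "3 * c\<^sup>2 \<le> 4 * (a\<^sup>2 - x\<^sup>2) * c\<^sup>2" by linarith
  then show ?thesis using c by (simp add: mult_le_cancel_right)
qed

text \<open>The planar configuration enters only through numbers: \<open>T\<close> holds the
  coordinates of the collinear points, \<open>x\<close> that of the foot and \<open>H\<close> the
  squared height of the remaining point. All distances in the new set already occur in the old one,
  except the simplex edges of length 1, which \<open>D \<ge> 1\<close> accommodates.\<close>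

lemma integral_point_set_axis_simplex:
  fixes T :: "real set" and x H D :: real
  assumes T: "finite T" "card T \<ge> 2"
    and TT: "\<And>s t. s \<in> T \<Longrightarrow> t \<in> T \<Longrightarrow> \<bar>s - t\<bar> \<in> \<int> \<and> \<bar>s - t\<bar> \<le> D"
    and Tx: "\<And>t. t \<in> T \<Longrightarrow> sqrt ((x - t)\<^sup>2 + H) \<in> \<int> \<and> sqrt ((x - t)\<^sup>2 + H) \<le> D"
    and H: "H > 1/2" and D: "D \<ge> 1" and m: "CARD('m::finite) \<ge> 2"
  shows "\<exists>S :: (real ^ 'm) set.
    integral_point_set S \<and> card S = card T + CARD('m) - 1 \<and> diameter S \<le> D"
proof -
  fix i :: 'm
  define M where "M = real CARD('m) - 1"
  define c :: real where "c = 1 / sqrt 2"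
  have c: "c > 0" "c\<^sup>2 = 1/2" by (auto simp: c_def power_divide)
  have cc: "c * c = 1/2" using c by (simp add: power2_eq_square)
  have M: "M \<ge> 1" using m by (simp add: M_def)
  \<comment> \<open>The left side of the equation is the squared length of
    \<open>u *\<^sub>R w + c *\<^sub>R axis j 1\<close> for the vector \<open>w\<close> introduced
    below. At \<open>u = 0\<close> it equals 1/2, whence the hypothesis on \<open>H\<close>; the
    endpoint \<open>H + 1\<close> is just a convenient place where it exceeds
    \<open>H\<close>.\<close>
  have "\<exists>u\<ge>0. u \<le> H + 1 \<and> M * u\<^sup>2 + 2 * u * c + 1/2 = H"
  proof (rule IVT')
    have "H + 1 \<le> (H + 1)\<^sup>2" using H by (simp add: power2_eq_square)
    also have "\<dots> \<le> M * (H + 1)\<^sup>2" using M by (simp add: mult_le_cancel_right1)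
    moreover have "0 \<le> 2 * (H + 1) * c" using H c by simp
    ultimately show "H \<le> M * (H + 1)\<^sup>2 + 2 * (H + 1) * c + 1/2" by linarith
  qed (use H in \<open>auto intro!: continuous_intros\<close>)
  then obtain u where u: "u \<ge> 0" "M * u\<^sup>2 + 2 * u * c + 1/2 = H" by blast
  \<comment> \<open>The vectors \<open>c *\<^sub>R axis j 1\<close> are the vertices of a regular
    simplex with edge \<open>c * sqrt 2 = 1\<close>. Moving them along their axis of symmetry
    \<open>w\<close> keeps them equidistant from the \<open>i\<close>-th axis and tunes that
    distance to \<open>sqrt H\<close>.\<close>
  define w :: "real ^ 'm" where "w = (\<chi> k. if k = i then 0 else 1)"
  define f :: "real \<Rightarrow> real ^ 'm" where "f t = t *\<^sub>R axis i 1" for t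
  define g :: "'m \<Rightarrow> real ^ 'm" where "g j = x *\<^sub>R axis i 1 + u *\<^sub>R w + c *\<^sub>R axis j 1" for j
  define J where "J = UNIV - {i}"
  have sumw: "(\<Sum>k\<in>UNIV. if k = i then 0 else h k) = (\<Sum>k\<in>J. h k)" for h :: "'m \<Rightarrow> real"
    by (simp add: J_def sum.If_cases Collect_neg_eq[symmetric] Compl_eq_Diff_UNIV)
  have cardJ: "card J = CARD('m) - 1" "real (card J) = M"
    using m by (auto simp: J_def M_def card_Diff_singleton)
  have ww: "w \<bullet> w = M"
    using sumw[of "\<lambda>_. 1"] cardJ by (simp add: w_def inner_vec_def if_distrib cong: if_cong)
  have wi: "w \<bullet> axis k 1 = (if k = i then 0 else 1)" "axis k 1 \<bullet> w = (if k = i then 0 else 1)" for k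
    by (auto simp: w_def inner_axis inner_axis')
  have ax: "axis k (1::real) \<bullet> axis l 1 = (if k = l then 1 else 0)" for k l :: 'm
    by (simp add: inner_axis_axis)
  have dff: "dist (f s) (f t) = \<bar>s - t\<bar>" for s t
    by (simp add: f_def dist_norm flip: scaleR_left_diff_distrib)
  have dfg: "dist (g j) (f t) = sqrt ((x - t)\<^sup>2 + H)" if "j \<in> J" for j t
  proof -
    have "j \<noteq> i" "i \<noteq> j" using that by (auto simp: J_def)
    have "g j - f t = (x - t) *\<^sub>R axis i 1 + u *\<^sub>R w + c *\<^sub>R axis j 1"
      by (simp add: g_def f_def algebra_simps)
    then have "(g j - f t) \<bullet> (g j - f t) = (x - t)\<^sup>2 + (M * u\<^sup>2 + 2 * u * c + c\<^sup>2)"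
      using \<open>j \<noteq> i\<close> \<open>i \<noteq> j\<close>
      by (simp add: inner_add_left inner_add_right ax wi ww) (simp add: power2_eq_square algebra_simps)
    then show ?thesis using u c by (simp add: dist_norm norm_eq_sqrt_inner)
  qed
  have dgg: "dist (g j) (g k) = (if j = k then 0 else 1)" for j k
  proof -
    have "g j - g k = c *\<^sub>R (axis j 1 - axis k 1)"
      by (simp add: g_def algebra_simps)
    then have "(g j - g k) \<bullet> (g j - g k) = (if j = k then 0 else 1)"
      using cc by (simp add: inner_diff_left inner_diff_right ax)
    then show ?thesis by (simp add: dist_norm norm_eq_sqrt_inner)
  qed
  define S where "S = f ` T \<union> g ` J"
  have "inj f" by (rule injI) (simp add: f_def axis_eq_0_iff)
  have "inj g" by (metis (no_types) dgg dist_self injI zero_neq_one)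
  have "f ` T \<inter> g ` J = {}"
  proof -
    have "g j \<noteq> f t" if "j \<in> J" for j t
    proof
      assume "g j = f t"
      then have "(x - t)\<^sup>2 + H = 0" using dfg[OF that, of t] by simp
      then show False using H zero_le_power2[of "x - t"] by linarith
    qed
    then show ?thesis by (metis disjoint_iff imageE)
  qed
  then have "card S = card T + card J"
    unfolding S_def using T \<open>inj f\<close> \<open>inj g\<close>
    by (subst card_Un_disjoint) (auto simp: card_image inj_on_subset)
  then have card: "card S = card T + CARD('m) - 1" using cardJ m by simp
  have S: "dist p q \<in> \<int> \<and> dist p q \<le> D" if "p \<in> S" "q \<in> S" for p q
    using that D unfolding S_def
    by (auto simp: dff dfg dgg TT Tx dist_commute[of "f _" "g _"])
  have "\<not> (\<exists>a b. a \<noteq> 0 \<and> S \<subseteq> {x. a \<bullet> x = b})"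
  proof safe
    fix a :: "real ^ 'm" and b
    assume "a \<noteq> 0" and sub: "S \<subseteq> {x. a \<bullet> x = b}"
    obtain s t where st: "s \<in> T" "t \<in> T" "s \<noteq> t"
      using T(2) by (metis One_nat_def Suc_1 card_le_Suc0_iff_eq T(1) not_less_eq_eq)
    have "a \<bullet> f s = b" "a \<bullet> f t = b"
      using st sub by (auto simp: S_def)
    then have "s * a $ i = b" "t * a $ i = b"
      by (auto simp: f_def inner_axis)
    \<comment> \<open>Two distinct points on the axis force a containing hyperplane to contain the
      whole axis, so only the simplex vertices remain to be used.\<close>
    then have ai: "a $ i = 0" and b: "b = 0"
      using st by auto
    define s where "s = a \<bullet> w"
    have aj: "u * s + c * a $ j = 0" if "j \<in> J" for j
    proof -
      have "a \<bullet> g j = b" using that sub by (auto simp: S_def)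
      then show ?thesis by (simp add: g_def s_def inner_add_right inner_axis ai b)
    qed
    have s_eq: "s = (\<Sum>j\<in>J. a $ j)"
      using sumw[of "\<lambda>k. a $ k"] by (simp add: s_def w_def inner_vec_def if_distrib cong: if_cong)
    \<comment> \<open>Summing the equations of all simplex vertices leaves a single equation in
      \<open>s\<close>, the sum of the coordinates of \<open>a\<close>; its coefficient is positive
      since \<open>u\<close> is nonnegative.\<close>
    have "0 = (\<Sum>j\<in>J. u * s + c * a $ j)" using aj by simp
    also have "\<dots> = (M * u + c) * s"
      by (simp add: sum.distrib s_eq cardJ(2) algebra_simps flip: sum_distrib_left)
    finally have "(M * u + c) * s = 0" by simp
    moreover have "M * u + c > 0" using u M c by (intro add_nonneg_pos) auto
    ultimately have "s = 0" by simp
    then have "a $ k = 0" for k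
      using aj[of k] ai c by (cases "k = i") (auto simp: J_def)
    then show False using \<open>a \<noteq> 0\<close> by (simp add: vec_eq_iff)
  qed
  moreover have "finite S" using T by (simp add: S_def)
  ultimately have "integral_point_set S" using S by (auto simp: integral_point_set_def)
  moreover have "diameter S \<le> D"
    using S D by (intro diameter_le) (auto simp: dist_norm)
  ultimately show ?thesis using card by blast
qed

text \<open>This supplies signed arc-length coordinates along the line: the inner product with the
  unit vector \<open>v\<close> reads off the affine parameter, so that distances become differences
  of coordinates.\<close>

lemma collinear_on_unit_line:
  fixes Q :: "'a::euclidean_space set"
  assumes "collinear Q" "p \<in> Q" "q \<in> Q" "p \<noteq> q" "r \<in> Q"
  defines "v \<equiv> sgn (q - p)"
  shows "r = p + ((r - p) \<bullet> v) *\<^sub>R v"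
proof -
  have "collinear {p, r, q}"
    using assms by (auto intro: collinear_subset)
  then obtain u where u: "r = u *\<^sub>R p + (1 - u) *\<^sub>R q"
    using \<open>p \<noteq> q\<close> by (auto simp: collinear_3_expand)
  define k where "k = 1 - u"
  have k: "r = p + k *\<^sub>R (q - p)"
    by (simp add: u k_def algebra_simps)
  have "(q - p) = norm (q - p) *\<^sub>R v" using \<open>p \<noteq> q\<close> by (simp add: v_def sgn_div_norm)
  then have "r - p = (k * norm (q - p)) *\<^sub>R v" using k by (metis add_diff_cancel_left' scaleR_scaleR)
  moreover have "v \<bullet> v = 1" using \<open>p \<noteq> q\<close> by (simp add: v_def dot_square_norm norm_sgn)
  ultimately show ?thesis by (simp add: algebra_simps)
qed

theorem theorem3:
  fixes n :: nat and P :: "(real ^ 2) set"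
  assumes "n \<ge> 3"
    and "integral_point_set P"
    and "card P = n"
    and "\<exists>Q. Q \<subseteq> P \<and> card Q = n - 1 \<and> collinear Q"
    and "CARD('m::finite) \<ge> 2"
  shows "min_diam TYPE(real ^ 'm) (n - 2 + CARD('m)) \<le> diameter P"
proof -
  obtain Q where Q: "Q \<subseteq> P" "card Q = n - 1" "collinear Q"
    using assms by blast
  have finP: "finite P" and Pint: "\<And>x y. x \<in> P \<Longrightarrow> y \<in> P \<Longrightarrow> dist x y \<in> \<int>"
    and Pplane: "\<And>a b. a \<noteq> 0 \<Longrightarrow> \<not> P \<subseteq> {x. a \<bullet> x = b}"
    using assms(2) by (auto simp: integral_point_set_def)
  have diam: "dist x y \<le> diameter P" if "x \<in> P" "y \<in> P" for x y
    using that finP by (intro diameter_bounded_bound finite_imp_bounded)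
  have finQ: "finite Q" using finP Q finite_subset by blast
  have "card (P - Q) = 1"
    using Q finQ assms by (simp add: card_Diff_subset)
  then obtain A where A: "P - Q = {A}" by (metis card_1_singletonE)
  have AP: "A \<in> P" and PQ: "P = insert A Q" using A Q by blast+
  obtain p q where pq: "p \<in> Q" "q \<in> Q" "p \<noteq> q"
    using Q(2) \<open>n \<ge> 3\<close> finQ card_le_Suc0_iff_eq[OF finQ] by fastforce
  define v where "v = sgn (q - p)"
  have vv: "v \<bullet> v = 1" using pq by (simp add: v_def dot_square_norm norm_sgn)
  define t where "t r = (r - p) \<bullet> v" for r
  have line: "r = p + t r *\<^sub>R v" if "r \<in> Q" for r
    using collinear_on_unit_line[OF Q(3) pq that] by (simp add: t_def v_def)
  \<comment> \<open>\<open>x\<close> is the coordinate of the foot of the perpendicular from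
    \<open>A\<close>, and \<open>H\<close> is the squared distance of \<open>A\<close> from the
    line, by Pythagoras.\<close>
  define x where "x = t A"
  define H where "H = (dist A p)\<^sup>2 - x\<^sup>2"
  have dQ: "dist r s = \<bar>t r - t s\<bar>" if "r \<in> Q" "s \<in> Q" for r s
  proof -
    have "r - s = (t r - t s) *\<^sub>R v"
      using line[OF that(1)] line[OF that(2)] by (metis add_diff_cancel_left scaleR_left_diff_distrib)
    moreover have "norm v = 1" using vv by (simp add: norm_eq_1)
    ultimately show ?thesis by (simp add: dist_norm)
  qed
  have dA2: "(dist A (p + k *\<^sub>R v))\<^sup>2 = (x - k)\<^sup>2 + H" for k
  proof -
    define y where "y = A - p"
    have "(dist A (p + k *\<^sub>R v))\<^sup>2 = (y - k *\<^sub>R v) \<bullet> (y - k *\<^sub>R v)"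
      by (simp add: y_def dist_norm power2_norm_eq_inner diff_diff_eq)
    also have "\<dots> = y \<bullet> y - 2 * k * (y \<bullet> v) + k\<^sup>2"
      by (simp add: inner_diff_left inner_diff_right inner_commute[of v y] vv power2_eq_square
          right_diff_distrib)
    also have "\<dots> = (x - k)\<^sup>2 + H"
      by (simp add: power2_diff H_def dist_norm x_def t_def power2_norm_eq_inner flip: y_def)
    finally show ?thesis .
  qed
  have dAQ2: "(dist A r)\<^sup>2 = (x - t r)\<^sup>2 + H" if "r \<in> Q" for r
    using dA2[of "t r"] unfolding line[OF that, symmetric] .
  have dAQ: "dist A r = sqrt ((x - t r)\<^sup>2 + H)" if "r \<in> Q" for r
    using dAQ2[OF that] by (metis real_sqrt_unique zero_le_dist)
  \<comment> \<open>At the foot itself, \<open>k = x\<close>, the squared distance is exactly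
    \<open>H\<close>.\<close>
  have "H \<ge> 0"
    using dA2[of x] by (metis add_0 diff_self power_zero_numeral zero_le_power2)
  \<comment> \<open>Otherwise \<open>A\<close> is its own foot and all of \<open>P\<close> lies on
    one line.\<close>
  have "H \<noteq> 0"
  proof
    assume "H = 0"
    then have "A = p + x *\<^sub>R v" using dA2[of x] by simp
    then have *: "r = p + t r *\<^sub>R v" if "r \<in> P" for r
      using that PQ line x_def by auto
    obtain a where a: "a \<noteq> 0" "orthogonal v a"
      using orthogonal_to_vector_exists[of v] by auto
    have "a \<bullet> r = a \<bullet> p" if "r \<in> P" for r
      by (subst *[OF that]) (use a in \<open>simp add: inner_add_right orthogonal_def inner_commute\<close>)
    then show False using Pplane[OF a(1), of "a \<bullet> p"] by blast
  qed
  have tq: "t q = dist p q"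
    using pq by (simp add: t_def v_def sgn_div_norm dot_square_norm dist_norm norm_minus_commute power2_eq_square)
  \<comment> \<open>Any two points of \<open>Q\<close> form with \<open>A\<close> a nondegenerate
    integral triangle of squared height \<open>H\<close>; \<open>p\<close> and \<open>q\<close> are
    taken because \<open>p\<close> is the origin of the coordinate \<open>t\<close>.\<close>
  have "H \<ge> 3/4"
    unfolding H_def
  proof (rule integral_triangle_height_ge[where b = "dist A q" and c = "dist p q"])
    have "(dist A q)\<^sup>2 = (x - dist p q)\<^sup>2 + H"
      using dAQ2[OF pq(2)] tq by simp
    then show "2 * x * dist p q = (dist A p)\<^sup>2 + (dist p q)\<^sup>2 - (dist A q)\<^sup>2"
      by (simp add: H_def power2_eq_square algebra_simps)
    show "dist A p \<le> dist A q + dist p q" "dist A q \<le> dist A p + dist p q"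
      by metric+
    show "0 < (dist A p)\<^sup>2 - x\<^sup>2"
      using \<open>H \<ge> 0\<close> \<open>H \<noteq> 0\<close> by (simp add: H_def)
  qed (use Pint AP pq Q in auto)
  \<comment> \<open>A positive integral distance is at least 1, so the unit edges of the simplex do
    not exceed the old diameter.\<close>
  have "dist p q \<in> \<int>" "dist p q > 0" using Pint pq Q by auto
  then have "1 \<le> dist p q" using Ints_nonzero_abs_ge1[of "dist p q"] by simp
  then have D: "1 \<le> diameter P" using diam[of p q] pq Q by force
  have "inj_on t Q"
    using line by (metis inj_onI)
  then have cardT: "card (t ` Q) = n - 1" using Q by (simp add: card_image)
  have "\<exists>S :: (real ^ 'm) set. integral_point_set S \<and>
      card S = card (t ` Q) + CARD('m) - 1 \<and> diameter S \<le> diameter P"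
  proof (rule integral_point_set_axis_simplex[where x = x and H = H])
    show "\<bar>s - s'\<bar> \<in> \<int> \<and> \<bar>s - s'\<bar> \<le> diameter P" if sT: "s \<in> t ` Q" "s' \<in> t ` Q" for s s'
    proof -
      obtain r r' where r: "r \<in> Q" "r' \<in> Q" "s = t r" "s' = t r'" using sT by blast
      then have "r \<in> P" "r' \<in> P" using Q(1) by auto
      then show ?thesis using Pint[of r r'] diam[of r r'] dQ[OF r(1,2)] r(3,4) by simp
    qed
    show "sqrt ((x - s)\<^sup>2 + H) \<in> \<int> \<and> sqrt ((x - s)\<^sup>2 + H) \<le> diameter P" if sT: "s \<in> t ` Q" for s
    proof -
      obtain r where r: "r \<in> Q" "s = t r" using sT by blast
      then have "r \<in> P" using Q(1) by auto
      then show ?thesis using Pint[OF AP, of r] diam[OF AP, of r] dAQ[OF r(1)] r(2) by simp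
    qed
  qed (use \<open>H \<ge> 3/4\<close> D assms(1,5) cardT finQ in auto)
  then obtain S :: "(real ^ 'm) set" where S: "integral_point_set S"
      "card S = card (t ` Q) + CARD('m) - 1" "diameter S \<le> diameter P"
    by blast
  \<comment> \<open>The count is \<open>n - 1\<close> points on the axis plus
    \<open>CARD('m) - 1\<close> simplex vertices; \<open>n >= 3\<close> keeps the natural-number
    subtractions exact.\<close>
  have "card S = n - 2 + CARD('m)" using S(2) cardT assms(1,5) by simp
  from min_diam_attained(2)[OF S(1) this] S(3) show ?thesis by linarith
qed

end
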